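(* Let $U\in\mathbb{R}^{n\times n}$. (a) Let $\rho\ge 0$ and $\mathcal{Z}=\{\Delta\in\mathbb{R}^{n\times n}:\ \|\Delta\|\le\rho\}$, where $\|\cdot\|$ is a general matrix norm. Then $\delta^*_{\mathcal{Z}}(U)=\rho\|U\|^*$. (b) Let $\mathcal{Z}=\{\Delta:\ \Delta^l\preceq\Delta\preceq\Delta^u\}$, where $\Delta^l,\Delta^u$ are given symmetric $n\times n$ matrices such that $\Delta^u-\Delta^l\succ 0_{n\times n}$. Then $$\delta^*_{\mathcal{Z}}(U)=\min_{\Lambda_1,\Lambda_2}\left\{\mathrm{trace}(\Delta^u\Lambda_2)-\mathrm{trace}(\Delta^l\Lambda_1):\ \Lambda_2-\Lambda_1=\frac{U+U^T}{2},\ \Lambda_1,\Lambda_2\succeq 0_{n\times n}\right\}.$$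
   Context: Support function: for a convex set $\mathcal{Z}\subseteq\mathbb{R}^{n\times n}$, $\delta^*_{\mathcal{Z}}(U):=\sup_{\Delta\in\mathcal{Z}}\mathrm{trace}(\Delta U^T)$. Dual norm of a matrix norm $\|\cdot\|$ (any norm on the vector space $\mathbb{R}^{n\times n}$): $\|A\|^*=\max_{\|B\|=1}\mathrm{trace}(B^TA)$. $M\succeq N$ (resp. $M\succ N$) means that $M-N$ is symmetric positive semi-definite (resp. symmetric positive definite); in particular the elements of $\mathcal{Z}$ in (b) are symmetric. *)

theory Defs
  imports "HOL-Analysis.Analysis"
begin

definition matrix_norm :: "(real^'n^'n \<Rightarrow> real) \<Rightarrow> bool" where
  "matrix_norm N \<longleftrightarrow>
     (\<forall>A. 0 \<le> N A) \<and> (\<forall>A. N A = 0 \<longleftrightarrow> A = 0) \<and>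
     (\<forall>c A. N (c *\<^sub>R A) = \<bar>c\<bar> * N A) \<and> (\<forall>A B. N (A + B) \<le> N A + N B)"

text \<open>The maximum is \<^const>\<open>Greatest\<close>; it is attained whenever \<open>N\<close> is a norm, see
  \<open>dual_norm_max\<close> below.\<close>

definition dual_norm :: "(real^'n^'n \<Rightarrow> real) \<Rightarrow> real^'n^'n \<Rightarrow> real" where
  "dual_norm N A = (GREATEST t. \<exists>B. N B = 1 \<and> t = trace (transpose B ** A))"

text \<open>Extended real values, so that the supremum is meaningful for unbounded sets as well.\<close>

definition support_function :: "(real^'n^'n) set \<Rightarrow> real^'n^'n \<Rightarrow> ereal" where
  "support_function Z U = (SUP D\<in>Z. ereal (trace (D ** transpose U)))"

definition psd :: "real^'n^'n \<Rightarrow> bool" where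
  "psd A \<longleftrightarrow> transpose A = A \<and> (\<forall>x. 0 \<le> x \<bullet> (A *v x))"

definition pd :: "real^'n^'n \<Rightarrow> bool" where
  "pd A \<longleftrightarrow> transpose A = A \<and> (\<forall>x. x \<noteq> 0 \<longrightarrow> 0 < x \<bullet> (A *v x))"

definition loewner_le :: "real^'n^'n \<Rightarrow> real^'n^'n \<Rightarrow> bool" (infix "\<preceq>\<^sub>L" 50) where
  "A \<preceq>\<^sub>L B \<longleftrightarrow> psd (B - A)"

definition loewner_less :: "real^'n^'n \<Rightarrow> real^'n^'n \<Rightarrow> bool" (infix "\<prec>\<^sub>L" 50) where
  "A \<prec>\<^sub>L B \<longleftrightarrow> pd (B - A)"

lemma matrix_norm_lipschitz:
  fixes N :: "real^'n^'n \<Rightarrow> real"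
  assumes N: "matrix_norm N"
  obtains C where "0 \<le> C" and "\<And>A B. \<bar>N A - N B\<bar> \<le> C * norm (A - B)"
proof
  have scale: "N (c *\<^sub>R A) = \<bar>c\<bar> * N A" and tri: "N (A + B) \<le> N A + N B"
    and nn: "0 \<le> N A" and zero: "N 0 = 0" for c A B
    using N unfolding matrix_norm_def by auto
  let ?C = "\<Sum>b\<in>Basis. N b"
  show "0 \<le> ?C" by (simp add: nn sum_nonneg)
  have bound: "N A \<le> ?C * norm A" for A
  proof -
    have sum_le: "N (\<Sum>b\<in>S. f b) \<le> (\<Sum>b\<in>S. N (f b))" if "finite S"
      for S and f :: "real^'n^'n \<Rightarrow> real^'n^'n"
      using that
    proof induction
      case (insert x F)
      then show ?case using tri[of "f x" "sum f F"] by simp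
    qed (simp add: zero)
    have "N A = N (\<Sum>b\<in>Basis. (A \<bullet> b) *\<^sub>R b)" by (simp add: euclidean_representation)
    also have "\<dots> \<le> (\<Sum>b\<in>Basis. N ((A \<bullet> b) *\<^sub>R b))" by (rule sum_le) simp
    also have "\<dots> \<le> (\<Sum>b\<in>Basis. norm A * N b)"
      by (rule sum_mono) (simp add: scale nn Basis_le_norm mult_right_mono)
    finally show ?thesis by (simp add: sum_distrib_left mult.commute)
  qed
  show "\<bar>N A - N B\<bar> \<le> ?C * norm (A - B)" for A B
  proof -
    have "N (B - A) = N (A - B)" using scale[of "-1" "A - B"] by simp
    then show ?thesis
      using tri[of "A - B" B] tri[of "B - A" A] bound[of "A - B"] by simp
  qed
qed

lemma dual_norm_max:
  fixes N :: "real^'n^'n \<Rightarrow> real"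
  assumes N: "matrix_norm N"
  shows "\<exists>B. N B = 1 \<and> dual_norm N A = trace (transpose B ** A)"
    and "N B = 1 \<Longrightarrow> trace (transpose B ** A) \<le> dual_norm N A"
proof -
  have scale: "N (c *\<^sub>R A) = \<bar>c\<bar> * N A"
    and nn: "0 \<le> N A" and zero: "N A = 0 \<longleftrightarrow> A = 0" for c A
    using N unfolding matrix_norm_def by auto
  obtain C where "0 \<le> C" and C: "\<And>A B. \<bar>N A - N B\<bar> \<le> C * norm (A - B)"
    using matrix_norm_lipschitz[OF N] by blast
  have cont: "continuous_on S N" for S
    by (rule lipschitz_on_continuous_on[where L=C], rule lipschitz_onI)
      (use \<open>0 \<le> C\<close> C in \<open>auto simp: dist_norm\<close>)
  have tr: "trace (transpose B ** A) = B \<bullet> A" for B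
    unfolding trace_def matrix_matrix_mult_def transpose_def inner_vec_def
    by simp (rule sum.swap)
  have "sphere (0::real^'n^'n) 1 \<noteq> {}" by simp
  then obtain X where X: "X \<in> sphere 0 1" "\<And>Y. Y \<in> sphere 0 1 \<Longrightarrow> N X \<le> N Y"
    using continuous_attains_inf[OF compact_sphere _ cont] by metis
  have "X \<noteq> 0" using X(1) by auto
  then have pos: "0 < N X" using nn[of X] zero[of X] by linarith
  have low: "N X * norm Y \<le> N Y" for Y
  proof (cases "Y = 0")
    case False
    then have "N X \<le> N ((1 / norm Y) *\<^sub>R Y)" by (intro X(2)) simp
    with False show ?thesis by (simp add: scale field_simps)
  qed (simp add: nn)
  have "closed {B. N B = 1}"
    using continuous_closed_preimage[OF cont[of UNIV], of "{1}"] by (simp add: vimage_def)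
  moreover have "bounded {B. N B = 1}"
    by (rule boundedI[where B="1 / N X"])
      (use low pos in \<open>auto simp: field_simps\<close>, metis)
  ultimately have "compact {B. N B = 1}" by (simp add: compact_eq_bounded_closed)
  moreover have "(1 / N X) *\<^sub>R X \<in> {B. N B = 1}" using pos by (simp add: scale)
  moreover have "continuous_on {B. N B = 1} (\<lambda>B. B \<bullet> A)" by (intro continuous_intros)
  ultimately obtain M where M: "N M = 1" "\<And>B. N B = 1 \<Longrightarrow> B \<bullet> A \<le> M \<bullet> A"
    using continuous_attains_sup[of "{B. N B = 1}" "\<lambda>B. B \<bullet> A"]
    by blast
  have dn: "dual_norm N A = M \<bullet> A"
    unfolding dual_norm_def tr by (rule Greatest_equality) (use M in auto)
  show "\<exists>B. N B = 1 \<and> dual_norm N A = trace (transpose B ** A)"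
    using M(1) dn tr by auto
  show "N B = 1 \<Longrightarrow> trace (transpose B ** A) \<le> dual_norm N A"
    using M(2) dn tr by simp
qed

end

theory Submission
  imports Defs
begin

text \<open>
  Part (a) is Hoelder's inequality for the dual norm, with equality at \<open>\<rho>\<close> times a dual maximizer.
  For part (b) put \<open>W = \<Delta>\<^sup>u - \<Delta>\<^sup>l\<close> and \<open>S = (U + U\<^sup>T) / 2\<close>. Weak duality holds because the inner product
  of two positive semidefinite matrices is nonnegative. Since \<open>W\<close> is positive definite, there is an
  invertible \<open>R\<close> such that \<open>W = R R\<^sup>T\<close> and \<open>R\<^sup>T S R\<close> is diagonal, say with entries \<open>d\<close>. Substituting
  \<open>\<Delta> = \<Delta>\<^sup>l + R Y R\<^sup>T\<close>, the problem becomes to maximize \<open>\<Sum>i. d i * Y i i\<close> subject to \<open>0 \<preceq> Y \<preceq> 1\<close>, which is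
  solved by the diagonal indicator of \<open>d > 0\<close>. With \<open>V\<close> the inverse of \<open>R\<close>, the matrices
  \<open>V\<^sup>T diag(d\<^sup>-) V\<close> and \<open>V\<^sup>T diag(d\<^sup>+) V\<close> are a dual solution of the same value.
\<close>

section \<open>The trace inner product\<close>

lemma trace_mult_transpose_eq_inner:
  fixes A B :: "real^'n^'m"
  shows "trace (A ** transpose B) = A \<bullet> B"
  by (simp add: trace_def matrix_matrix_mult_def transpose_def inner_vec_def)

lemma trace_mult_symmetric_eq_inner:
  fixes A B :: "real^'n^'n"
  assumes "transpose B = B"
  shows "trace (A ** B) = A \<bullet> B"
  using trace_mult_transpose_eq_inner[of A B] by (simp add: assms)

lemma trace_transpose_mult_eq_inner:
  fixes A B :: "real^'n^'m"
  shows "trace (transpose A ** B) = A \<bullet> B"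
  by (simp add: trace_mul_sym[of _ B] trace_mult_transpose_eq_inner inner_commute)

lemma inner_matrix_mult_left:
  fixes A :: "real^'n^'m" and B :: "real^'k^'n"
  shows "(A ** B) \<bullet> C = B \<bullet> (transpose A ** C)"
  by (simp add: matrix_transpose_mul matrix_mul_assoc flip: trace_transpose_mult_eq_inner)

lemma inner_matrix_mult_right:
  fixes A :: "real^'n^'m" and B :: "real^'k^'n"
  shows "(A ** B) \<bullet> C = A \<bullet> (C ** transpose B)"
  by (simp add: matrix_transpose_mul matrix_mul_assoc flip: trace_mult_transpose_eq_inner)

lemma transpose_add:
  fixes A B :: "'a::plus^'n^'m"
  shows "transpose (A + B) = transpose A + transpose B"
  by (simp add: transpose_def vec_eq_iff)

lemma transpose_diff:
  fixes A B :: "'a::minus^'n^'m"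
  shows "transpose (A - B) = transpose A - transpose B"
  by (simp add: transpose_def vec_eq_iff)

definition sym_part :: "real^'n^'n \<Rightarrow> real^'n^'n" where
  "sym_part A = (1/2) *\<^sub>R (A + transpose A)"

lemma transpose_sym_part [simp]: "transpose (sym_part A) = sym_part A"
  by (simp add: sym_part_def transpose_scalar transpose_add add.commute)

lemma inner_sym_part:
  fixes A B :: "real^'n^'n"
  assumes "transpose A = A"
  shows "A \<bullet> sym_part B = A \<bullet> B"
proof -
  have "A \<bullet> transpose B = A \<bullet> B"
    using trace_transpose_mult_eq_inner[of A "transpose B"] trace_mult_transpose_eq_inner[of A B]
    by (simp add: assms)
  then show ?thesis by (simp add: sym_part_def inner_add_right)
qed

section \<open>Diagonal matrices and congruence\<close>

definition diag :: "('n \<Rightarrow> 'a::zero) \<Rightarrow> 'a^'n^'n" where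
  "diag d = (\<chi> i j. if i = j then d i else 0)"

lemma diag_component: "diag d $ i $ j = (if i = j then d i else 0)"
  by (simp add: diag_def)

lemma diag_const: "diag (\<lambda>_. c) = mat c"
  by (simp add: diag_def mat_def)

lemma transpose_diag [simp]: "transpose (diag d) = diag d"
  by (simp add: vec_eq_iff transpose_def diag_component)

lemma diag_diff:
  fixes d e :: "'n::finite \<Rightarrow> 'a::group_add"
  shows "diag d - diag e = diag (\<lambda>i. d i - e i)"
  by (simp add: vec_eq_iff diag_component)

lemma diag_mult:
  fixes d e :: "'n::finite \<Rightarrow> 'a::semiring_1"
  shows "diag d ** diag e = diag (\<lambda>i. d i * e i)"
  by (simp add: vec_eq_iff matrix_matrix_mult_def diag_component if_distrib[of "\<lambda>x. x * _"] cong: if_cong)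

lemma invertible_diag:
  fixes d :: "'n::finite \<Rightarrow> 'a::field"
  assumes "\<And>i. d i \<noteq> 0"
  shows "invertible (diag d)"
  unfolding invertible_def using assms
  by (intro exI[of _ "diag (\<lambda>i. inverse (d i))"]) (simp add: diag_mult diag_const)

lemma inner_diag:
  fixes A :: "real^'n^'n"
  shows "diag d \<bullet> A = (\<Sum>i\<in>UNIV. d i * A $ i $ i)"
  by (simp add: inner_vec_def diag_component if_distrib[of "\<lambda>x. x * _"] cong: if_cong)

definition congruence :: "'a::comm_semiring_1^'n^'m \<Rightarrow> 'a^'n^'n \<Rightarrow> 'a^'m^'m" where
  "congruence C A = C ** A ** transpose C"

lemma congruence_component:
  fixes A :: "real^'n^'n"
  shows "congruence C A $ i $ j = C $ i \<bullet> (A *v C $ j)"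
proof -
  have "congruence C A $ i $ j = (C ** A) $ i \<bullet> C $ j"
    by (simp add: congruence_def matrix_matrix_mult_def transpose_def inner_vec_def)
  also have "(C ** A) $ i = C $ i v* A"
    by (simp add: vec_eq_iff matrix_matrix_mult_def vector_matrix_mult_def)
  finally show ?thesis by (simp add: dot_lmul_matrix)
qed

lemma transpose_congruence: "transpose (congruence C A) = congruence C (transpose A)"
  by (simp add: congruence_def matrix_transpose_mul matrix_mul_assoc)

lemma congruence_congruence: "congruence B (congruence C A) = congruence (B ** C) A"
  by (simp add: congruence_def matrix_transpose_mul matrix_mul_assoc)

lemma congruence_mat_1 [simp]: "congruence (mat 1) A = A"
  by (simp add: congruence_def)

lemma congruence_diff:
  fixes C :: "'a::comm_ring_1^'n^'m"
  shows "congruence C (A - B) = congruence C A - congruence C B"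
  by (simp add: congruence_def matrix_eq matrix_vector_mult_diff_rdistrib matrix_vector_mult_diff_distrib
      flip: matrix_vector_mul_assoc)

lemma congruence_diag_sqrt:
  assumes "\<And>i. 0 \<le> d i"
  shows "congruence (diag (\<lambda>i. sqrt (d i))) (mat 1) = diag d"
  using assms by (simp add: congruence_def diag_mult)

lemma inner_congruence:
  fixes C :: "real^'n^'m"
  shows "congruence C A \<bullet> B = A \<bullet> congruence (transpose C) B"
proof -
  have "congruence C A \<bullet> B = (C ** A) \<bullet> (B ** C)"
    by (simp add: congruence_def inner_matrix_mult_right)
  also have "\<dots> = A \<bullet> congruence (transpose C) B"
    by (simp add: congruence_def inner_matrix_mult_left matrix_mul_assoc)
  finally show ?thesis .
qed

lemma inner_congruence_inverse:
  fixes R :: "real^'n^'m" and V :: "real^'m^'n"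
  assumes "V ** R = mat 1"
  shows "congruence R A \<bullet> congruence (transpose V) B = A \<bullet> B"
  using assms
  by (simp add: inner_congruence congruence_congruence flip: matrix_transpose_mul)

lemma orthogonal_matrix_imp_invertible: "orthogonal_matrix Q \<Longrightarrow> invertible Q"
  by (auto simp: orthogonal_matrix_def invertible_def)

lemma congruence_orthogonal_cancel:
  "orthogonal_matrix Q \<Longrightarrow> congruence (transpose Q) (congruence Q A) = A"
  by (simp add: congruence_congruence orthogonal_matrix_def)

lemma congruence_orthogonal_mat_1: "orthogonal_matrix Q \<Longrightarrow> congruence Q (mat 1) = mat 1"
  by (simp add: congruence_def orthogonal_matrix_def)

section \<open>The spectral theorem\<close>

definition selfadjoint :: "('a::real_inner \<Rightarrow> 'a) \<Rightarrow> bool" where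
  "selfadjoint f \<longleftrightarrow> linear f \<and> (\<forall>x y. f x \<bullet> y = x \<bullet> f y)"

lemma linear_coeff_eq_0_if_quadratic_nonneg:
  fixes b c :: real
  assumes "\<And>t. 0 \<le> b * t + c * t\<^sup>2"
  shows "b = 0"
proof (rule DERIV_local_min[of _ b 0 1])
  show "((\<lambda>t. b * t + c * t\<^sup>2) has_real_derivative b) (at 0)"
    by (auto intro!: derivative_eq_intros)
qed (use assms in auto)

lemma selfadjoint_Rayleigh_maximizer_eigenvector:
  fixes f :: "'a::real_inner \<Rightarrow> 'a"
  assumes "selfadjoint f" and S: "subspace S" and v: "v \<in> S" "norm v = 1" "f v \<in> S"
    and v_max: "\<And>x. x \<in> S \<Longrightarrow> norm x = 1 \<Longrightarrow> x \<bullet> f x \<le> v \<bullet> f v"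
  shows "f v = (v \<bullet> f v) *\<^sub>R v"
proof -
  interpret linear f using \<open>selfadjoint f\<close> by (simp add: selfadjoint_def)
  define \<mu> where "\<mu> = v \<bullet> f v"
  define g where "g x = \<mu> * (x \<bullet> x) - x \<bullet> f x" for x
  define r where "r = \<mu> *\<^sub>R v - f v"
  have g_nonneg: "0 \<le> g x" if "x \<in> S" for x
  proof (cases "x = 0")
    case False
    with that have "(1 / norm x) *\<^sub>R x \<in> S" "norm ((1 / norm x) *\<^sub>R x) = 1"
      by (simp_all add: S subspace_scale)
    from v_max[OF this] have "(x \<bullet> f x) / (x \<bullet> x) \<le> \<mu>"
      by (simp add: \<mu>_def scale power2_eq_square flip: power2_norm_eq_inner)
    with False show ?thesis by (simp add: g_def pos_divide_le_eq)
  qed (simp add: g_def)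
  have "r \<in> S" using v S by (simp add: r_def subspace_scale subspace_diff)
  have "0 \<le> (2 * (r \<bullet> r)) * t + g r * t\<^sup>2" for t
  proof -
    have "g v = 0" using v by (simp add: g_def \<mu>_def dot_square_norm)
    moreover have "f v \<bullet> r = v \<bullet> f r" using \<open>selfadjoint f\<close> by (simp add: selfadjoint_def)
    then have "g (v + t *\<^sub>R r) = g v + 2 * t * ((\<mu> *\<^sub>R v - f v) \<bullet> r) + t\<^sup>2 * g r"
      by (simp add: g_def add scale inner_simps inner_commute power2_eq_square algebra_simps)
    ultimately have "g (v + t *\<^sub>R r) = (2 * (r \<bullet> r)) * t + g r * t\<^sup>2"
      by (simp flip: r_def)
    then show ?thesis
      using g_nonneg[of "v + t *\<^sub>R r"] v \<open>r \<in> S\<close> S by (simp add: subspace_add subspace_scale)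
  qed
  then have "2 * (r \<bullet> r) = 0" by (rule linear_coeff_eq_0_if_quadratic_nonneg)
  then show ?thesis by (simp add: r_def \<mu>_def)
qed

lemma selfadjoint_eigenvector_exists:
  fixes f :: "'a::euclidean_space \<Rightarrow> 'a"
  assumes "selfadjoint f" and S: "subspace S" "S \<noteq> {0}" and invariant: "f ` S \<subseteq> S"
  obtains v \<mu> where "v \<in> S" "norm v = 1" "f v = \<mu> *\<^sub>R v"
proof -
  obtain x where "x \<in> S" "x \<noteq> 0" using S subspace_0 by blast
  then have "(1 / norm x) *\<^sub>R x \<in> S \<inter> sphere 0 1" by (simp add: S subspace_scale)
  moreover have "compact (S \<inter> sphere 0 1)" by (simp add: S closed_Int_compact closed_subspace)
  moreover have "continuous_on (S \<inter> sphere 0 1) (\<lambda>x. x \<bullet> f x)"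
    using \<open>selfadjoint f\<close> unfolding selfadjoint_def linear_conv_bounded_linear
    by (intro continuous_intros linear_continuous_on) blast
  ultimately obtain v where v: "v \<in> S \<inter> sphere 0 1"
    and "\<And>x. x \<in> S \<inter> sphere 0 1 \<Longrightarrow> x \<bullet> f x \<le> v \<bullet> f v"
    using continuous_attains_sup[of "S \<inter> sphere 0 1" "\<lambda>x. x \<bullet> f x"] by blast
  then have "f v = (v \<bullet> f v) *\<^sub>R v"
    using invariant assms(1) S(1) by (intro selfadjoint_Rayleigh_maximizer_eigenvector) auto
  with v show ?thesis by (intro that[of v "v \<bullet> f v"]) auto
qed

lemma span_insert_orthogonal_complement:
  fixes S :: "'a::real_inner set"
  assumes S: "subspace S" and v: "v \<in> S" "norm v = 1"
    and span_B: "span B = S \<inter> {x. v \<bullet> x = 0}"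
  shows "span (insert v B) = S"
proof
  show "S \<subseteq> span (insert v B)"
  proof
    fix x assume "x \<in> S"
    with S v have "x - (v \<bullet> x) *\<^sub>R v \<in> span B"
      by (simp add: span_B subspace_diff subspace_scale inner_diff_right dot_square_norm)
    then show "x \<in> span (insert v B)" unfolding span_insert by blast
  qed
  have "insert v B \<subseteq> S" using v span_B span_superset[of B] by blast
  then show "span (insert v B) \<subseteq> S" using S by (rule span_minimal)
qed

theorem selfadjoint_orthonormal_eigenbasis:
  fixes f :: "'a::euclidean_space \<Rightarrow> 'a"
  assumes "selfadjoint f" and "subspace S" "f ` S \<subseteq> S"
  shows "\<exists>B. pairwise orthogonal B \<and> (\<forall>b\<in>B. norm b = 1) \<and> span B = S \<and> (\<forall>b\<in>B. \<exists>\<mu>. f b = \<mu> *\<^sub>R b)"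
  using \<open>subspace S\<close> \<open>f ` S \<subseteq> S\<close>
proof (induction "dim S" arbitrary: S rule: less_induct)
  case less
  show ?case
  proof (cases "S = {0}")
    case True
    then show ?thesis by (intro exI[of _ "{}"]) simp
  next
    case False
    then obtain v \<mu> where v: "v \<in> S" "norm v = 1" and eigen_v: "f v = \<mu> *\<^sub>R v"
      using selfadjoint_eigenvector_exists[OF assms(1) less.prems(1) _ less.prems(2)] by blast
    define T where "T = S \<inter> {x. v \<bullet> x = 0}"
    have "subspace T" by (simp add: T_def less.prems(1) subspace_hyperplane subspace_inter)
    have "v \<notin> T" using v(2) by (auto simp: T_def)
    with v(1) have "T \<subset> S" unfolding T_def by blast
    then have "dim T < dim S"
      using \<open>subspace T\<close> less.prems(1) by (intro dim_psubset) (simp add: span_eq_iff[THEN iffD2])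
    moreover have "v \<bullet> f x = \<mu> * (v \<bullet> x)" for x
      using assms(1) eigen_v by (metis selfadjoint_def inner_scaleR_left)
    then have "f ` T \<subseteq> T" using less.prems(2) by (auto simp: T_def)
    ultimately obtain B where orthogonal_B: "pairwise orthogonal B"
      and norm_B: "\<forall>b\<in>B. norm b = 1" and span_B: "span B = T"
      and eigen_B: "\<forall>b\<in>B. \<exists>\<mu>. f b = \<mu> *\<^sub>R b"
      using less.hyps \<open>subspace T\<close> by blast
    have "\<forall>b\<in>B. orthogonal v b"
      using span_superset[of B] by (auto simp: span_B T_def orthogonal_def)
    then have "pairwise orthogonal (insert v B)"
      using orthogonal_B by (simp add: pairwise_insert orthogonal_commute)
    moreover have "span (insert v B) = S"
      using span_insert_orthogonal_complement[OF less.prems(1) v] span_B by (simp add: T_def)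
    ultimately show ?thesis
      using v(2) eigen_v norm_B eigen_B by (intro exI[of _ "insert v B"]) auto
  qed
qed

lemma orthogonal_matrix_of_orthonormal_basis:
  fixes B :: "(real^'n) set"
  assumes "pairwise orthogonal B" and norm_B: "\<forall>b\<in>B. norm b = 1" and "span B = UNIV"
  obtains Q :: "real^'n^'n" where "orthogonal_matrix Q" "rows Q = B"
proof -
  have "independent B"
    using assms(1) norm_B by (intro pairwise_orthogonal_independent) auto
  then have "finite B" "card B = CARD('n)"
    using basis_card_eq_dim[of B UNIV] by (simp_all add: independent_imp_finite assms(3))
  then obtain h where "bij_betw h (UNIV :: 'n set) B"
    by (metis finite_class.finite_UNIV finite_same_card_bij)
  then have "inj h" and range_h: "range h = B" by (auto simp: bij_betw_def)
  show ?thesis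
  proof
    have "orthogonal (h i) (h j)" if "i \<noteq> j" for i j
      using assms(1) range_h \<open>inj h\<close> that by (auto simp: inj_eq intro: pairwiseD)
    moreover have "norm (h i) = 1" for i using norm_B range_h by blast
    ultimately show "orthogonal_matrix (\<chi> i. h i)"
      by (simp add: orthogonal_matrix_orthonormal_rows row_def)
    show "rows (\<chi> i. h i) = B" using range_h by (auto simp: rows_def row_def)
  qed
qed

lemma selfadjoint_symmetric_matrix:
  fixes A :: "real^'n^'n"
  assumes "transpose A = A"
  shows "selfadjoint ((*v) A)"
  unfolding selfadjoint_def
  using assms by (metis dot_lmul_matrix transpose_matrix_vector matrix_vector_mul_linear)

theorem symmetric_orthogonal_diagonalization:
  fixes A :: "real^'n^'n"
  assumes "transpose A = A"
  obtains Q d where "orthogonal_matrix Q" "congruence Q A = diag d"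
proof -
  obtain B where "pairwise orthogonal B" "\<forall>b\<in>B. norm b = 1" "span B = UNIV"
    and eigen_B: "\<forall>b\<in>B. \<exists>\<mu>. A *v b = \<mu> *\<^sub>R b"
    using selfadjoint_orthonormal_eigenbasis[OF selfadjoint_symmetric_matrix[OF assms], of UNIV]
    by auto
  then obtain Q where orthogonal_Q: "orthogonal_matrix Q" and "rows Q = B"
    using orthogonal_matrix_of_orthonormal_basis by blast
  then have "\<forall>i. \<exists>\<mu>. A *v Q $ i = \<mu> *\<^sub>R Q $ i"
    using eigen_B by (auto simp: rows_def row_def)
  then obtain d where eigen_Q: "A *v Q $ i = d i *\<^sub>R Q $ i" for i by metis
  have "Q $ i \<bullet> Q $ j = mat 1 $ i $ j" for i j
    using congruence_component[of Q "mat 1" i j]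
    by (simp add: congruence_orthogonal_mat_1[OF orthogonal_Q])
  then have "congruence Q A = diag d"
    by (simp add: vec_eq_iff congruence_component eigen_Q diag_component mat_def)
  with orthogonal_Q show ?thesis by (rule that)
qed

section \<open>Positive semidefinite matrices\<close>

lemma quadratic_form_congruence:
  fixes C :: "real^'n^'m"
  shows "x \<bullet> (congruence C A *v x) = (transpose C *v x) \<bullet> (A *v (transpose C *v x))"
  by (simp add: congruence_def dot_lmul_matrix flip: matrix_vector_mul_assoc)

lemma psd_congruence: "psd A \<Longrightarrow> psd (congruence C A)"
  by (simp add: psd_def transpose_congruence quadratic_form_congruence)

lemma psd_mat_1: "psd (mat 1)"
  by (simp add: psd_def)

lemma psd_diag:
  assumes "\<And>i. 0 \<le> d i"
  shows "psd (diag d)"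
  using psd_congruence[OF psd_mat_1, of "diag (\<lambda>i. sqrt (d i))"] assms
  by (simp add: congruence_diag_sqrt)

lemma psd_diagonal_nonneg:
  assumes "psd A"
  shows "0 \<le> A $ i $ i"
proof -
  have "A $ i $ i = axis i 1 \<bullet> (A *v axis i 1)"
    by (simp add: inner_axis inner_axis' matrix_vector_mul_component)
  with assms show ?thesis by (simp add: psd_def)
qed

lemma psd_inner_nonneg:
  assumes "psd A" "psd B"
  shows "0 \<le> A \<bullet> B"
proof -
  obtain Q d where orthogonal_Q: "orthogonal_matrix Q" and diag_A: "congruence Q A = diag d"
    using symmetric_orthogonal_diagonalization assms(1) unfolding psd_def by blast
  have "A \<bullet> B = congruence (transpose Q) (diag d) \<bullet> B"
    by (simp add: congruence_orthogonal_cancel[OF orthogonal_Q] flip: diag_A)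
  also have "\<dots> = (\<Sum>i\<in>UNIV. d i * congruence Q B $ i $ i)"
    by (simp add: inner_congruence inner_diag)
  also have "\<dots> \<ge> 0"
  proof (intro sum_nonneg mult_nonneg_nonneg)
    show "0 \<le> d i" for i
      using psd_diagonal_nonneg[OF psd_congruence[OF assms(1), of Q], of i]
      by (simp add: diag_A diag_component)
  qed (simp add: psd_diagonal_nonneg psd_congruence assms(2))
  finally show ?thesis .
qed

lemma pd_imp_congruent_mat_1:
  fixes W :: "real^'n^'n"
  assumes "pd W"
  obtains R :: "real^'n^'n" where "invertible R" "W = congruence R (mat 1)"
proof -
  obtain Q d where orthogonal_Q: "orthogonal_matrix Q" and diag_W: "congruence Q W = diag d"
    using symmetric_orthogonal_diagonalization assms unfolding pd_def by blast
  have d_pos: "0 < d i" for i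
  proof -
    have "norm (Q $ i) = 1"
      using orthogonal_Q by (simp add: orthogonal_matrix_orthonormal_rows row_def)
    then have "Q $ i \<noteq> 0" by auto
    then have "0 < congruence Q W $ i $ i"
      using assms by (simp add: congruence_component pd_def)
    then show ?thesis by (simp add: diag_W diag_component)
  qed
  let ?R = "transpose Q ** diag (\<lambda>i. sqrt (d i))"
  show ?thesis
  proof
    have "invertible (diag (\<lambda>i. sqrt (d i)))"
      by (rule invertible_diag) (simp add: d_pos[THEN less_imp_neq, symmetric])
    then show "invertible ?R"
      using orthogonal_matrix_imp_invertible[OF orthogonal_Q]
      by (simp add: invertible_mult transpose_invertible)
    have "W = congruence (transpose Q) (diag d)"
      using congruence_orthogonal_cancel[OF orthogonal_Q, of W] by (simp add: diag_W)
    also have "diag d = congruence (diag (\<lambda>i. sqrt (d i))) (mat 1)"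
      using d_pos by (simp add: congruence_diag_sqrt less_imp_le)
    finally show "W = congruence ?R (mat 1)" by (simp add: congruence_congruence)
  qed
qed

lemma pd_symmetric_simultaneous_diagonalization:
  fixes W S :: "real^'n^'n"
  assumes "pd W" and "transpose S = S"
  obtains R :: "real^'n^'n" and d
  where "invertible R" "W = congruence R (mat 1)" "congruence (transpose R) S = diag d"
proof -
  obtain C :: "real^'n^'n" where invertible_C: "invertible C" and W: "W = congruence C (mat 1)"
    using pd_imp_congruent_mat_1[OF assms(1)] by blast
  have "transpose (congruence (transpose C) S) = congruence (transpose C) S"
    by (simp add: transpose_congruence assms(2))
  then obtain Q d where orthogonal_Q: "orthogonal_matrix Q"
    and diag_S: "congruence Q (congruence (transpose C) S) = diag d"
    using symmetric_orthogonal_diagonalization by blast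
  show ?thesis
  proof
    show "invertible (C ** transpose Q)"
      using invertible_C orthogonal_matrix_imp_invertible[OF orthogonal_Q]
      by (simp add: invertible_mult transpose_invertible)
    show "W = congruence (C ** transpose Q) (mat 1)"
      by (simp add: W congruence_orthogonal_mat_1 orthogonal_Q flip: congruence_congruence)
    show "congruence (transpose (C ** transpose Q)) S = diag d"
      using diag_S by (simp add: matrix_transpose_mul congruence_congruence)
  qed
qed

section \<open>Semidefinite duality\<close>

lemma psd_interval_primal_dual_pair:
  fixes W S :: "real^'n^'n"
  assumes "pd W" and "transpose S = S"
  obtains Y M1 M2 where "psd Y" "psd (W - Y)" "psd M1" "psd M2" "M2 - M1 = S" "Y \<bullet> S = W \<bullet> M2"
proof -
  obtain R :: "real^'n^'n" and d where "invertible R" and W: "W = congruence R (mat 1)"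
    and diag_S: "congruence (transpose R) S = diag d"
    using pd_symmetric_simultaneous_diagonalization[OF assms] by blast
  then obtain V where RV: "R ** V = mat 1" and VR: "V ** R = mat 1"
    by (auto simp: invertible_def)
  define y where "y i = (of_bool (0 < d i) :: real)" for i
  define d_pos where "d_pos i = max (d i) 0" for i
  define d_neg where "d_neg i = max (- d i) 0" for i
  show ?thesis
  proof
    show "psd (congruence R (diag y))"
      by (simp add: psd_congruence psd_diag y_def)
    show "psd (W - congruence R (diag y))"
      unfolding W congruence_diff[symmetric] diag_const[symmetric] diag_diff
      by (simp add: psd_congruence psd_diag y_def)
    show "psd (congruence (transpose V) (diag d_neg))" "psd (congruence (transpose V) (diag d_pos))"
      by (simp_all add: psd_congruence psd_diag d_neg_def d_pos_def)
    have "d_pos i - d_neg i = d i" for i by (simp add: d_pos_def d_neg_def)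
    then have "diag d_pos - diag d_neg = diag d" by (simp add: diag_diff)
    moreover have "S = congruence (transpose V) (diag d)"
      by (simp add: congruence_congruence RV flip: diag_S matrix_transpose_mul)
    ultimately show "congruence (transpose V) (diag d_pos) - congruence (transpose V) (diag d_neg) = S"
      by (simp flip: congruence_diff)
    have y_mult: "y i * d i = d_pos i" for i by (simp add: y_def d_pos_def)
    have "congruence R (diag y) \<bullet> S = diag y \<bullet> diag d"
      by (simp add: inner_congruence diag_S)
    also have "\<dots> = (mat 1 :: real^'n^'n) \<bullet> diag d_pos"
      by (simp add: inner_diag diag_component y_mult flip: diag_const)
    also have "\<dots> = W \<bullet> congruence (transpose V) (diag d_pos)"
      by (simp add: W inner_congruence_inverse VR)
    finally show "congruence R (diag y) \<bullet> S = W \<bullet> congruence (transpose V) (diag d_pos)" .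
  qed
qed

lemma loewner_interval_weak_duality:
  assumes Dl: "transpose Dl = Dl" and D: "Dl \<preceq>\<^sub>L D" "D \<preceq>\<^sub>L Du"
    and M: "0 \<preceq>\<^sub>L M1" "0 \<preceq>\<^sub>L M2" "M2 - M1 = sym_part U"
  shows "D \<bullet> U \<le> trace (Du ** M2) - trace (Dl ** M1)"
proof -
  have "transpose D = D"
    using D(1) Dl by (simp add: loewner_le_def psd_def transpose_diff)
  then have "D \<bullet> U = D \<bullet> (M2 - M1)" by (simp only: M(3) inner_sym_part)
  also have "\<dots> \<le> Du \<bullet> M2 - Dl \<bullet> M1"
    using psd_inner_nonneg[of "Du - D" M2] psd_inner_nonneg[of "D - Dl" M1] D M(1,2)
    by (simp add: loewner_le_def inner_diff_left inner_diff_right)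
  also have "\<dots> = trace (Du ** M2) - trace (Dl ** M1)"
    using M(1,2) by (simp add: loewner_le_def psd_def trace_mult_symmetric_eq_inner)
  finally show ?thesis .
qed

lemma loewner_interval_strong_duality:
  assumes Dl: "transpose Dl = Dl" and "0 \<prec>\<^sub>L Du - Dl"
  obtains D M1 M2 where "Dl \<preceq>\<^sub>L D" "D \<preceq>\<^sub>L Du"
    and "0 \<preceq>\<^sub>L M1" "0 \<preceq>\<^sub>L M2" "M2 - M1 = sym_part U"
    and "D \<bullet> U = trace (Du ** M2) - trace (Dl ** M1)"
proof -
  obtain Y M1 M2 where Y: "psd Y" "psd (Du - Dl - Y)"
    and M: "psd M1" "psd M2" "M2 - M1 = sym_part U"
    and same_value: "Y \<bullet> sym_part U = (Du - Dl) \<bullet> M2"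
    using psd_interval_primal_dual_pair[of "Du - Dl" "sym_part U"] assms(2)
    by (auto simp: loewner_less_def)
  show ?thesis
  proof
    show "Dl \<preceq>\<^sub>L Dl + Y" "Dl + Y \<preceq>\<^sub>L Du" "0 \<preceq>\<^sub>L M1" "0 \<preceq>\<^sub>L M2"
      using Y M(1,2) by (simp_all add: loewner_le_def diff_diff_eq)
    have "transpose (Dl + Y) = Dl + Y"
      using Y(1) Dl by (simp add: psd_def transpose_add)
    then have "(Dl + Y) \<bullet> U = (Dl + Y) \<bullet> sym_part U" by (simp only: inner_sym_part)
    also have "\<dots> = Dl \<bullet> (M2 - M1) + (Du - Dl) \<bullet> M2"
      by (simp add: M(3) same_value inner_add_left)
    also have "\<dots> = trace (Du ** M2) - trace (Dl ** M1)"
      using M(1,2) by (simp add: psd_def trace_mult_symmetric_eq_inner inner_diff_left inner_diff_right)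
    finally show "(Dl + Y) \<bullet> U = trace (Du ** M2) - trace (Dl ** M1)" .
  qed (rule M(3))
qed

section \<open>Support functions\<close>

lemma support_function_eqI:
  assumes "D \<in> Z" "D \<bullet> U = m" "\<And>D'. D' \<in> Z \<Longrightarrow> D' \<bullet> U \<le> m"
  shows "support_function Z U = ereal m"
  unfolding support_function_def trace_mult_transpose_eq_inner
proof (rule antisym)
  show "(SUP D\<in>Z. ereal (D \<bullet> U)) \<le> ereal m" using assms(3) by (intro SUP_least) simp
  show "ereal m \<le> (SUP D\<in>Z. ereal (D \<bullet> U))" using assms(1,2) by (intro SUP_upper2[of D]) auto
qed

lemma inner_le_norm_mult_dual_norm:
  fixes N :: "real^'n^'n \<Rightarrow> real"
  assumes N: "matrix_norm N"
  shows "A \<bullet> U \<le> N A * dual_norm N U"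
proof (cases "A = 0")
  case True
  from N have "N 0 = 0" by (simp add: matrix_norm_def)
  with True show ?thesis by simp
next
  case False
  with N have pos: "0 < N A" unfolding matrix_norm_def by (metis less_eq_real_def)
  have "N ((1 / N A) *\<^sub>R A) = 1" using N False by (simp add: matrix_norm_def)
  from dual_norm_max(2)[OF N this, of U] have "((1 / N A) *\<^sub>R A) \<bullet> U \<le> dual_norm N U"
    by (simp only: trace_transpose_mult_eq_inner)
  with pos show ?thesis by (simp add: field_simps)
qed

lemma support_function_norm_ball:
  fixes N :: "real^'n^'n \<Rightarrow> real"
  assumes N: "matrix_norm N" and "0 \<le> \<rho>"
  shows "support_function {D. N D \<le> \<rho>} U = ereal (\<rho> * dual_norm N U)"
proof -
  obtain B where B: "N B = 1" "dual_norm N U = B \<bullet> U"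
    using dual_norm_max(1)[OF N, of U] by (auto simp: trace_transpose_mult_eq_inner)
  have scale: "N (c *\<^sub>R A) = \<bar>c\<bar> * N A" for c A
    using N by (simp add: matrix_norm_def)
  have dual_norm_nonneg: "0 \<le> dual_norm N U"
    using inner_le_norm_mult_dual_norm[OF N, of "- B" U] scale[of "-1" B] B by simp
  show ?thesis
  proof (rule support_function_eqI)
    show "\<rho> *\<^sub>R B \<in> {D. N D \<le> \<rho>}" using B(1) \<open>0 \<le> \<rho>\<close> by (simp add: scale)
    show "(\<rho> *\<^sub>R B) \<bullet> U = \<rho> * dual_norm N U" using B(2) by simp
    show "D \<bullet> U \<le> \<rho> * dual_norm N U" if "D \<in> {D. N D \<le> \<rho>}" for D
    proof -
      have "D \<bullet> U \<le> N D * dual_norm N U" by (rule inner_le_norm_mult_dual_norm[OF N])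
      also have "\<dots> \<le> \<rho> * dual_norm N U"
        using that dual_norm_nonneg by (simp add: mult_right_mono)
      finally show ?thesis .
    qed
  qed
qed

lemma support_function_loewner_interval:
  assumes Dl: "transpose Dl = Dl" and "0 \<prec>\<^sub>L Du - Dl"
  shows "\<exists>L1 L2.
    is_arg_min (\<lambda>(M1, M2). trace (Du ** M2) - trace (Dl ** M1))
      (\<lambda>(M1, M2). M2 - M1 = sym_part U \<and> 0 \<preceq>\<^sub>L M1 \<and> 0 \<preceq>\<^sub>L M2) (L1, L2) \<and>
    support_function {D. Dl \<preceq>\<^sub>L D \<and> D \<preceq>\<^sub>L Du} U = ereal (trace (Du ** L2) - trace (Dl ** L1))"
proof -
  obtain D L1 L2 where D: "Dl \<preceq>\<^sub>L D" "D \<preceq>\<^sub>L Du"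
    and L: "0 \<preceq>\<^sub>L L1" "0 \<preceq>\<^sub>L L2" "L2 - L1 = sym_part U"
    and same_value: "D \<bullet> U = trace (Du ** L2) - trace (Dl ** L1)"
    using loewner_interval_strong_duality[OF assms] by blast
  have "is_arg_min (\<lambda>(M1, M2). trace (Du ** M2) - trace (Dl ** M1))
      (\<lambda>(M1, M2). M2 - M1 = sym_part U \<and> 0 \<preceq>\<^sub>L M1 \<and> 0 \<preceq>\<^sub>L M2) (L1, L2)"
    using L loewner_interval_weak_duality[OF Dl D]
    by (auto simp: is_arg_min_linorder simp flip: same_value)
  moreover have "support_function {D. Dl \<preceq>\<^sub>L D \<and> D \<preceq>\<^sub>L Du} U
      = ereal (trace (Du ** L2) - trace (Dl ** L1))"
    using D same_value loewner_interval_weak_duality[OF Dl _ _ L]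
    by (intro support_function_eqI[of D]) auto
  ultimately show ?thesis by blast
qed

theorem lemma3:
  fixes U :: "real^'n^'n"
  shows "(\<forall>(N :: real^'n^'n \<Rightarrow> real) (\<rho>::real). matrix_norm N \<and> 0 \<le> \<rho> \<longrightarrow>
            support_function {D. N D \<le> \<rho>} U = ereal (\<rho> * dual_norm N U)) \<and>
         (\<forall>(Dl :: real^'n^'n) (Du :: real^'n^'n).
            transpose Dl = Dl \<and> transpose Du = Du \<and> 0 \<prec>\<^sub>L Du - Dl \<longrightarrow>
            (\<exists>L1 L2.
               is_arg_min (\<lambda>(M1, M2). trace (Du ** M2) - trace (Dl ** M1))
                 (\<lambda>(M1, M2). M2 - M1 = (1/2) *\<^sub>R (U + transpose U) \<and> 0 \<preceq>\<^sub>L M1 \<and> 0 \<preceq>\<^sub>L M2)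
                 (L1, L2) \<and>
               support_function {D. Dl \<preceq>\<^sub>L D \<and> D \<preceq>\<^sub>L Du} U
                 = ereal (trace (Du ** L2) - trace (Dl ** L1))))"
  using support_function_norm_ball support_function_loewner_interval
  unfolding sym_part_def by blast

end
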